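(* Let $\Gamma$ be a rotating boundary periodic orbit of a surface of section $\Sigma$ of a Reeb flow (as in the context). If $\Gamma$ is elliptic and its Floquet multipliers are not roots of unity, then the extension $P$ of the first return map to the boundary component $\Gamma\subset\partial\Sigma$ has no periodic points.
   Context: $(N,\lambda)$ closed contact 3-manifold, Reeb flow $\psi_t$, contact structure $\xi=\ker\lambda$ (invariant under $d\psi_t$). $\Sigma$ is a surface of section (compact immersed surface with boundary, interior embedded and transversal to the Reeb field, boundary covering closed orbits) with a boundary orbit $\Gamma$ which is rotating: there is a neighbourhood of $\Gamma$ in $\Sigma$ on which the first return times of $\psi_t$ and $\psi_{-t}$ to $\Sigma$ are bounded. The surface $\Sigma$ has an asymptotic direction $e(t)\in\xi(\Gamma(t))$ along $\Gamma$ (its limit tangent direction transversal to the flow), which rotates more slowly than its image under the linearized flow. The extension of the return map to $\Gamma$ is $P(\Gamma(t))=\Gamma(b(t))$ with $b(t)=t+\min\{s>0:\exists c>0,\ d\psi_s(e(t))=c\,e(t+s)\}$. *)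

theory Defs
  imports "HOL-Analysis.Analysis"
begin

text \<open>Linearized Reeb flow along a closed orbit of period T, written in a T-periodic
  (positively oriented) frame of the contact plane field along the orbit:
  lin_flow t s is the matrix of d psi_s : xi(Gamma t) -> xi(Gamma (t+s)).\<close>

definition rot2 :: "real \<Rightarrow> real^2^2" where
  "rot2 a = vector [vector [cos a, - sin a], vector [sin a, cos a]]"

definition complexify :: "real^2^2 \<Rightarrow> complex^2^2" where
  "complexify M = (\<chi> i j. complex_of_real (M $ i $ j))"

text \<open>Floquet multipliers: the (complex) eigenvalues of the monodromy d psi_T.\<close>
definition floquet_multipliers :: "real^2^2 \<Rightarrow> complex set" where
  "floquet_multipliers M = {z. det (complexify M - mat z) = 0}"

definition elliptic_monodromy :: "real^2^2 \<Rightarrow> bool" where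
  "elliptic_monodromy M \<longleftrightarrow>
     (\<forall>z \<in> floquet_multipliers M. cmod z = 1 \<and> z \<notin> \<real>)"

definition root_of_unity :: "complex \<Rightarrow> bool" where
  "root_of_unity z \<longleftrightarrow> (\<exists>n::nat. n \<ge> 1 \<and> z ^ n = 1)"

text \<open>A linearized flow along a T-periodic orbit: a continuous cocycle of
  area-preserving linear maps of the contact plane, in a T-periodic frame.\<close>
definition linearized_flow :: "real \<Rightarrow> (real \<Rightarrow> real \<Rightarrow> real^2^2) \<Rightarrow> bool" where
  "linearized_flow T \<Phi> \<longleftrightarrow> T > 0 \<and>
     continuous_on UNIV (\<lambda>(t, s). \<Phi> t s) \<and>
     (\<forall>t. \<Phi> t 0 = mat 1) \<and>
     (\<forall>t s r. \<Phi> t (s + r) = \<Phi> (t + s) r ** \<Phi> t s) \<and>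
     (\<forall>t s. \<Phi> (t + T) s = \<Phi> t s) \<and>
     (\<forall>t s. det (\<Phi> t s) = 1)"

text \<open>Asymptotic direction e along Gamma (T-periodic, continuous, non-vanishing).\<close>
definition asymptotic_direction :: "real \<Rightarrow> (real \<Rightarrow> real^2) \<Rightarrow> bool" where
  "asymptotic_direction T e \<longleftrightarrow> continuous_on UNIV e \<and>
     (\<forall>t. e (t + T) = e t) \<and> (\<forall>t. e t \<noteq> 0)"

text \<open>e rotates more slowly than its image under the linearized flow: the
  continuous angle from e(t+s) to d psi_s (e t), starting at 0 for s = 0,
  is strictly increasing in s \<ge> 0.\<close>
definition rotates_slower :: "(real \<Rightarrow> real \<Rightarrow> real^2^2) \<Rightarrow> (real \<Rightarrow> real^2) \<Rightarrow> bool" where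
  "rotates_slower \<Phi> e \<longleftrightarrow> (\<exists>\<theta> :: real \<Rightarrow> real \<Rightarrow> real. \<forall>t.
     continuous_on {0..} (\<theta> t) \<and> \<theta> t 0 = 0 \<and> strict_mono_on {0..} (\<theta> t) \<and>
     (\<forall>s \<ge> 0. \<exists>c > 0. \<Phi> t s *v e t = c *\<^sub>R (rot2 (\<theta> t s) *v e (t + s))))"

text \<open>Return times of the directions; b t = t + min of them.\<close>
definition return_set :: "(real \<Rightarrow> real \<Rightarrow> real^2^2) \<Rightarrow> (real \<Rightarrow> real^2) \<Rightarrow> real \<Rightarrow> real set" where
  "return_set \<Phi> e t = {s. s > 0 \<and> (\<exists>c > 0. \<Phi> t s *v e t = c *\<^sub>R e (t + s))}"

definition boundary_return :: "(real \<Rightarrow> real \<Rightarrow> real^2^2) \<Rightarrow> (real \<Rightarrow> real^2) \<Rightarrow> real \<Rightarrow> real" where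
  "boundary_return \<Phi> e t = t + (LEAST s. s \<in> return_set \<Phi> e t)"

end

theory Submission
  imports Defs
begin

text \<open>Because e rotates more slowly than its image under the linearized flow, the first
  return time of the direction e t is the time at which the relative angle reaches 2\<pi>,
  and return times compose along the cocycle. A periodic point of P therefore yields a
  positive multiple S = m T of the period such that the linearized flow over time S maps
  e t to a positive multiple c of itself; conjugating back to the base point, the power M^m
  of the monodromy M has the positive eigenvalue c. By Cayley-Hamilton, M^m = p M + q with
  real p, q, and z^m = p z + q for every Floquet multiplier z. If p \<noteq> 0 the eigenvector
  of M^m is an eigenvector of M with a real eigenvalue, which ellipticity forbids; if p = 0
  then z^m = c with |z| = 1, so z is a root of unity.\<close>

lemma periodic_add_nat_mult:
  assumes "\<And>t. f (t + T) = f t"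
  shows "f (t + real m * T) = f t"
proof (induction m)
  case (Suc m)
  have "t + real (Suc m) * T = (t + real m * T) + T"
    by (simp add: algebra_simps)
  then show ?case
    using Suc assms by metis
qed simp

lemma funpow_semiconj:
  assumes "\<And>x. f (h x) = h (g x)"
  shows "(f ^^ n) (h x) = h ((g ^^ n) x)"
  by (induction n) (simp_all add: assms)

lemma matrix_vector_mult_2:
  fixes M :: "'a::comm_ring_1^2^2"
  shows "(M *v x) $ 1 = M$1$1 * x$1 + M$1$2 * x$2"
    and "(M *v x) $ 2 = M$2$1 * x$1 + M$2$2 * x$2"
  by (simp_all add: matrix_vector_mult_def sum_2)

lemma vec_eq_iff_2: "(x::'a^2) = y \<longleftrightarrow> x$1 = y$1 \<and> x$2 = y$2"
  by (simp add: vec_eq_iff forall_2)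

lemma trace_2: "trace (M::'a::semiring_1^2^2) = M$1$1 + M$2$2"
  by (simp add: trace_def sum_2)

lemma cayley_hamilton_2:
  fixes M :: "real^2^2"
  shows "M *v (M *v x) = trace M *\<^sub>R (M *v x) - det M *\<^sub>R x"
  by (simp add: vec_eq_iff_2 matrix_vector_mult_2 trace_2 det_2 algebra_simps)

lemma det_complexify_minus_mat:
  "det (complexify M - mat z) = z\<^sup>2 - of_real (trace M) * z + of_real (det M)"
  by (simp add: det_2 trace_2 complexify_def mat_def power2_eq_square algebra_simps)

lemma floquet_multipliers_nonempty: "\<exists>z. z \<in> floquet_multipliers M"
proof -
  define \<tau> where "\<tau> = complex_of_real (trace M)"
  define w where "w = csqrt (\<tau>\<^sup>2 - 4 * of_real (det M))"
  have "((\<tau> + w) / 2)\<^sup>2 - \<tau> * ((\<tau> + w) / 2) + of_real (det M)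
      = (w\<^sup>2 - (\<tau>\<^sup>2 - 4 * of_real (det M))) / 4"
    by (simp add: field_simps power2_eq_square)
  also have "\<dots> = 0"
    by (simp add: w_def)
  finally have "(\<tau> + w) / 2 \<in> floquet_multipliers M"
    unfolding floquet_multipliers_def det_complexify_minus_mat \<tau>_def by simp
  then show ?thesis ..
qed

lemma real_eigenvalue_in_floquet_multipliers:
  assumes "M *v u = \<mu> *\<^sub>R u" and "u \<noteq> 0"
  shows "complex_of_real \<mu> \<in> floquet_multipliers M"
proof -
  have "(\<mu> * \<mu>) *\<^sub>R u = (trace M * \<mu> - det M) *\<^sub>R u"
    using cayley_hamilton_2[of M u] assms(1)
    by (simp add: matrix_vector_mult_scaleR algebra_simps)
  then have "\<mu> * \<mu> = trace M * \<mu> - det M"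
    using assms(2) scaleR_cancel_right by blast
  then have "complex_of_real (\<mu> * \<mu> - trace M * \<mu> + det M) = 0"
    by simp
  then show ?thesis
    by (simp add: floquet_multipliers_def det_complexify_minus_mat power2_eq_square)
qed

lemma matrix_power_linear_combination:
  assumes "z \<in> floquet_multipliers M"
  shows "\<exists>p q. ((*v) M ^^ j) u = p *\<^sub>R (M *v u) + q *\<^sub>R u \<and>
    z ^ j = of_real p * z + of_real q"
proof (induction j)
  case 0
  show ?case
    by (rule exI[of _ 0], rule exI[of _ 1]) simp
next
  case (Suc j)
  then obtain p q where pq: "((*v) M ^^ j) u = p *\<^sub>R (M *v u) + q *\<^sub>R u"
    "z ^ j = of_real p * z + of_real q" by blast
  have char: "z\<^sup>2 = of_real (trace M) * z - of_real (det M)"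
    using assms by (simp add: floquet_multipliers_def det_complexify_minus_mat algebra_simps)
  have "((*v) M ^^ Suc j) u = (p * trace M + q) *\<^sub>R (M *v u) + (- p * det M) *\<^sub>R u"
    by (simp add: pq matrix_vector_right_distrib matrix_vector_mult_scaleR cayley_hamilton_2
        algebra_simps)
  moreover have "z ^ Suc j = of_real p * z\<^sup>2 + of_real q * z"
    by (simp add: pq power2_eq_square algebra_simps)
  then have "z ^ Suc j = of_real (p * trace M + q) * z + of_real (- p * det M)"
    by (simp add: char algebra_simps)
  ultimately show ?case
    by blast
qed

lemma elliptic_power_positive_eigenvalue_imp_root_of_unity:
  assumes elliptic: "elliptic_monodromy M"
    and eigen: "((*v) M ^^ m) u = c *\<^sub>R u" and "u \<noteq> 0" "c > 0" "m \<ge> 1"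
  shows "\<exists>z \<in> floquet_multipliers M. root_of_unity z"
proof -
  obtain z where z: "z \<in> floquet_multipliers M"
    using floquet_multipliers_nonempty by blast
  then obtain p q where pq: "((*v) M ^^ m) u = p *\<^sub>R (M *v u) + q *\<^sub>R u"
    "z ^ m = of_real p * z + of_real q"
    using matrix_power_linear_combination by blast
  have combination: "p *\<^sub>R (M *v u) = (c - q) *\<^sub>R u"
    using pq(1) eigen by (simp add: algebra_simps)
  show ?thesis
  proof (cases "p = 0")
    case False
    then have "p *\<^sub>R (M *v u) = p *\<^sub>R (((c - q) / p) *\<^sub>R u)"
      using combination by simp
    then have "M *v u = ((c - q) / p) *\<^sub>R u"
      using False scaleR_cancel_left by blast
    then have "complex_of_real ((c - q) / p) \<in> floquet_multipliers M"
      using \<open>u \<noteq> 0\<close> by (rule real_eigenvalue_in_floquet_multipliers)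
    then show ?thesis
      using elliptic by (auto simp: elliptic_monodromy_def)
  next
    case True
    then have "q = c"
      using combination \<open>u \<noteq> 0\<close> by simp
    then have power: "z ^ m = of_real c"
      using pq(2) True by simp
    have "cmod z = 1"
      using z elliptic by (simp add: elliptic_monodromy_def)
    then have "c = 1"
      using arg_cong[OF power, of cmod] \<open>c > 0\<close> by (simp add: norm_power)
    then show ?thesis
      using z power \<open>m \<ge> 1\<close> by (auto simp: root_of_unity_def)
  qed
qed

lemma rot2_2pi: "rot2 (2 * pi) = mat 1"
  by (simp add: rot2_def vec_eq_iff forall_2 mat_def)

lemma rot2_positive_eigenvalue_imp_cos_eq_1:
  assumes "rot2 a *v x = r *\<^sub>R x" and "x \<noteq> 0" and "r > 0"
  shows "cos a = 1"
proof -
  have e1: "cos a * x$1 - sin a * x$2 = r * x$1" and e2: "sin a * x$1 + cos a * x$2 = r * x$2"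
    using assms(1) by (simp_all add: vec_eq_iff_2 matrix_vector_mult_2 rot2_def)
  have norm: "x$1 * x$1 + x$2 * x$2 \<noteq> 0"
    using assms(2) by (simp add: vec_eq_iff_2 add_nonneg_eq_0_iff)
  have "(cos a - r) * (x$1 * x$1 + x$2 * x$2)
      = (cos a * x$1 - sin a * x$2 - r * x$1) * x$1 + (sin a * x$1 + cos a * x$2 - r * x$2) * x$2"
    by (simp add: algebra_simps)
  then have "(cos a - r) * (x$1 * x$1 + x$2 * x$2) = 0"
    using e1 e2 by simp
  moreover have "sin a * (x$1 * x$1 + x$2 * x$2)
      = (sin a * x$1 + cos a * x$2 - r * x$2) * x$1 - (cos a * x$1 - sin a * x$2 - r * x$1) * x$2"
    by (simp add: algebra_simps)
  then have "sin a * (x$1 * x$1 + x$2 * x$2) = 0"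
    using e1 e2 by simp
  ultimately have "cos a = r" "sin a = 0"
    using norm by auto
  then show ?thesis
    using sin_cos_squared_add[of a] \<open>r > 0\<close> by (auto simp: power2_eq_1_iff)
qed

lemma linearized_flow_funpow_monodromy:
  assumes "linearized_flow T \<Phi>"
  shows "\<Phi> 0 (real m * T) *v x = ((*v) (\<Phi> 0 T) ^^ m) x"
proof (induction m)
  case (Suc m)
  have "\<Phi> 0 (real m * T + T) = \<Phi> (0 + real m * T) T ** \<Phi> 0 (real m * T)"
    using assms by (simp add: linearized_flow_def)
  also have "\<Phi> (0 + real m * T) T = \<Phi> 0 T"
    using periodic_add_nat_mult[of "\<lambda>t. \<Phi> t T" T 0 m] assms by (simp add: linearized_flow_def)
  finally show ?case
    using Suc by (simp add: algebra_simps flip: matrix_vector_mul_assoc)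
qed (use assms in \<open>simp add: linearized_flow_def\<close>)

text \<open>When S is a multiple of the period, \<Phi> t S is conjugate to \<Phi> 0 S by \<Phi> 0 t.\<close>

lemma linearized_flow_eigenvector_transport:
  assumes flow: "linearized_flow T \<Phi>"
    and eigen: "\<Phi> t (real m * T) *v v = c *\<^sub>R v" and "v \<noteq> 0"
  shows "\<exists>u. u \<noteq> 0 \<and> \<Phi> 0 (real m * T) *v u = c *\<^sub>R u"
proof -
  define S where "S = real m * T"
  have id: "\<And>t. \<Phi> t 0 = mat 1"
    and cocycle: "\<And>t s r. \<Phi> t (s + r) = \<Phi> (t + s) r ** \<Phi> t s"
    using flow by (auto simp: linearized_flow_def)
  have right_inv: "\<Phi> 0 t ** \<Phi> t (-t) = mat 1"
    using cocycle[of t "-t" t] id[of t] by simp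
  have left_inv: "\<Phi> t (-t) ** \<Phi> 0 t = mat 1"
    using cocycle[of 0 t "-t"] id[of 0] by simp
  have "\<Phi> S t = \<Phi> 0 t"
    using periodic_add_nat_mult[of "\<lambda>r. \<Phi> r t" T 0 m] flow by (simp add: S_def linearized_flow_def)
  then have conj: "\<Phi> t S ** \<Phi> 0 t = \<Phi> 0 t ** \<Phi> 0 S"
    using cocycle[of 0 t S] cocycle[of 0 S t] by (simp add: add.commute)
  define u where "u = \<Phi> t (-t) *v v"
  have v: "\<Phi> 0 t *v u = v"
    by (simp add: u_def matrix_vector_mul_assoc right_inv)
  have "\<Phi> 0 S *v u = (\<Phi> t (-t) ** \<Phi> 0 t) *v (\<Phi> 0 S *v u)"
    by (simp add: left_inv)
  also have "\<dots> = \<Phi> t (-t) *v ((\<Phi> t S ** \<Phi> 0 t) *v u)"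
    by (simp add: conj matrix_vector_mul_assoc matrix_mul_assoc)
  also have "\<dots> = \<Phi> t (-t) *v (\<Phi> t S *v v)"
    by (simp add: v flip: matrix_vector_mul_assoc)
  also have "\<dots> = c *\<^sub>R u"
    using eigen by (simp add: S_def u_def matrix_vector_mult_scaleR)
  finally show ?thesis
    using v \<open>v \<noteq> 0\<close> unfolding S_def by (metis matrix_vector_mult_0_right)
qed

lemma return_set_add:
  assumes "linearized_flow T \<Phi>"
    and "s \<in> return_set \<Phi> e t" and "r \<in> return_set \<Phi> e (t + s)"
  shows "s + r \<in> return_set \<Phi> e t"
proof -
  obtain c1 c2 where "s > 0" "c1 > 0" "\<Phi> t s *v e t = c1 *\<^sub>R e (t + s)"
    and "r > 0" "c2 > 0" "\<Phi> (t + s) r *v e (t + s) = c2 *\<^sub>R e (t + s + r)"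
    using assms(2,3) by (auto simp: return_set_def)
  moreover have "\<Phi> t (s + r) = \<Phi> (t + s) r ** \<Phi> t s"
    using assms(1) by (simp add: linearized_flow_def)
  ultimately have "\<Phi> t (s + r) *v e t = (c1 * c2) *\<^sub>R e (t + (s + r))"
    by (simp add: matrix_vector_mult_scaleR add.assoc flip: matrix_vector_mul_assoc)
  then show ?thesis
    using \<open>s > 0\<close> \<open>r > 0\<close> \<open>c1 > 0\<close> \<open>c2 > 0\<close>
    by (auto simp: return_set_def intro!: exI[of _ "c1 * c2"])
qed

text \<open>At a return time the rotation by the relative angle \<theta> fixes the ray of e, so \<theta> is
  a positive multiple of 2\<pi>.\<close>

lemma return_time_angle_ge_2pi:
  assumes "\<theta> 0 = 0" and "strict_mono_on {0..} \<theta>" and "e (t + s) \<noteq> 0"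
    and rot: "\<exists>c > 0. \<Phi> t s *v e t = c *\<^sub>R (rot2 (\<theta> s) *v e (t + s))"
    and return: "s \<in> return_set \<Phi> e t"
  shows "\<theta> s \<ge> 2 * pi"
proof -
  obtain c where "s > 0" "c > 0" and ret: "\<Phi> t s *v e t = c *\<^sub>R e (t + s)"
    using return by (auto simp: return_set_def)
  obtain c' where "c' > 0" and rotated: "\<Phi> t s *v e t = c' *\<^sub>R (rot2 (\<theta> s) *v e (t + s))"
    using rot by blast
  have "rot2 (\<theta> s) *v e (t + s) = (1 / c') *\<^sub>R (\<Phi> t s *v e t)"
    using rotated \<open>c' > 0\<close> by simp
  also have "\<dots> = (c / c') *\<^sub>R e (t + s)"
    using ret by simp
  finally have "cos (\<theta> s) = 1"
    by (rule rot2_positive_eigenvalue_imp_cos_eq_1[OF _ assms(3)])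
      (use \<open>c > 0\<close> \<open>c' > 0\<close> in simp)
  then obtain k :: int where k: "\<theta> s = real_of_int k * (2 * pi)"
    using cos_one_2pi_int by (auto simp: mult.assoc)
  have "\<theta> s > 0"
    using strict_mono_onD[OF assms(2), of 0 s] assms(1) \<open>s > 0\<close> by simp
  then have "real_of_int k \<ge> 1"
    using k by (simp add: zero_less_mult_iff)
  then have "1 * (2 * pi) \<le> real_of_int k * (2 * pi)"
    by (intro mult_right_mono) auto
  then show ?thesis
    using k by simp
qed

lemma boundary_return_in_return_set:
  assumes "rotates_slower \<Phi> e" and "\<And>t. e t \<noteq> 0" and "return_set \<Phi> e t \<noteq> {}"
  shows "boundary_return \<Phi> e t - t \<in> return_set \<Phi> e t"
proof -
  obtain \<theta> where cont: "continuous_on {0..} \<theta>" and "\<theta> 0 = 0"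
    and mono: "strict_mono_on {0..} \<theta>"
    and rot: "\<And>s. s \<ge> 0 \<Longrightarrow> \<exists>c > 0. \<Phi> t s *v e t = c *\<^sub>R (rot2 (\<theta> s) *v e (t + s))"
    using assms(1) unfolding rotates_slower_def by blast
  have ge: "\<theta> s \<ge> 2 * pi" if "s \<in> return_set \<Phi> e t" for s
  proof -
    have "s \<ge> 0"
      using that by (simp add: return_set_def)
    then show ?thesis
      using return_time_angle_ge_2pi[OF \<open>\<theta> 0 = 0\<close> mono assms(2)[of "t + s"] rot that] by blast
  qed
  obtain s0 where s0: "s0 \<in> return_set \<Phi> e t"
    using assms(3) by blast
  then have "s0 > 0"
    by (simp add: return_set_def)
  obtain s1 where "s1 \<ge> 0" and s1: "\<theta> s1 = 2 * pi"
    using IVT'[of \<theta> 0 "2 * pi" s0] continuous_on_subset[OF cont] ge[OF s0]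
      \<open>\<theta> 0 = 0\<close> \<open>s0 > 0\<close>
    by auto
  then have "s1 > 0"
    using \<open>\<theta> 0 = 0\<close> by (cases "s1 = 0") auto
  then have s1_return: "s1 \<in> return_set \<Phi> e t"
    using rot[of s1] s1 by (auto simp: return_set_def rot2_2pi)
  have "s1 \<le> s" if "s \<in> return_set \<Phi> e t" for s
  proof (rule ccontr)
    assume "\<not> s1 \<le> s"
    then have "\<theta> s < \<theta> s1"
      using that strict_mono_onD[OF mono, of s s1] by (simp add: return_set_def)
    then show False
      using ge[OF that] s1 by simp
  qed
  then have "(LEAST s. s \<in> return_set \<Phi> e t) = s1"
    using s1_return by (intro Least_equality) auto
  then show ?thesis
    using s1_return by (simp add: boundary_return_def)
qed

lemma funpow_boundary_return_in_return_set:
  assumes flow: "linearized_flow T \<Phi>"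
    and return: "\<And>t. boundary_return \<Phi> e t - t \<in> return_set \<Phi> e t" and "n \<ge> 1"
  shows "(boundary_return \<Phi> e ^^ n) t - t \<in> return_set \<Phi> e t"
  using \<open>n \<ge> 1\<close>
proof (induction n rule: nat_induct_at_least)
  case (Suc n)
  let ?b = "boundary_return \<Phi> e" and ?s = "(boundary_return \<Phi> e ^^ n) t - t"
  have "?b (t + ?s) - (t + ?s) \<in> return_set \<Phi> e (t + ?s)"
    by (rule return)
  then have "?s + (?b (t + ?s) - (t + ?s)) \<in> return_set \<Phi> e t"
    by (rule return_set_add[OF flow Suc.IH])
  then show ?case
    by simp
qed (use return in simp)

lemma return_at_period_multiple_imp_monodromy_eigenvector:
  assumes flow: "linearized_flow T \<Phi>" and dir: "asymptotic_direction T e"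
    and return: "real m * T \<in> return_set \<Phi> e t"
  shows "\<exists>u c. u \<noteq> 0 \<and> c > 0 \<and> ((*v) (\<Phi> 0 T) ^^ m) u = c *\<^sub>R u"
proof -
  obtain c where "c > 0" and ray: "\<Phi> t (real m * T) *v e t = c *\<^sub>R e (t + real m * T)"
    using return by (auto simp: return_set_def)
  have "e (t + real m * T) = e t" and "e t \<noteq> 0"
    using dir periodic_add_nat_mult[of e] by (auto simp: asymptotic_direction_def)
  then obtain u where "u \<noteq> 0" "\<Phi> 0 (real m * T) *v u = c *\<^sub>R u"
    using linearized_flow_eigenvector_transport[OF flow] ray by fastforce
  then show ?thesis
    using \<open>c > 0\<close> by (auto simp: linearized_flow_funpow_monodromy[OF flow])
qed

theorem proposition3p1:
  fixes T :: real
    and \<Gamma> :: "real \<Rightarrow> 'a"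
    and \<Phi> :: "real \<Rightarrow> real \<Rightarrow> real^2^2"
    and e :: "real \<Rightarrow> real^2"
    and P :: "'a \<Rightarrow> 'a"
  assumes flow: "linearized_flow T \<Phi>"
    and orbit: "\<forall>t t'. \<Gamma> t = \<Gamma> t' \<longleftrightarrow> (\<exists>k::int. t' = t + of_int k * T)"
    and dir: "asymptotic_direction T e"
    and slower: "rotates_slower \<Phi> e"
    and rotating: "\<forall>t. return_set \<Phi> e t \<noteq> {}"
    and P_ext: "\<forall>t. P (\<Gamma> t) = \<Gamma> (boundary_return \<Phi> e t)"
    and elliptic: "elliptic_monodromy (\<Phi> 0 T)"
    and irrational: "\<forall>z \<in> floquet_multipliers (\<Phi> 0 T). \<not> root_of_unity z"
  shows "\<not> (\<exists>x \<in> range \<Gamma>. \<exists>n::nat. n \<ge> 1 \<and> (P ^^ n) x = x)"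
proof
  assume "\<exists>x \<in> range \<Gamma>. \<exists>n::nat. n \<ge> 1 \<and> (P ^^ n) x = x"
  then obtain t n where "n \<ge> 1" and periodic: "(P ^^ n) (\<Gamma> t) = \<Gamma> t"
    by auto
  let ?b = "boundary_return \<Phi> e"
  have "\<And>t. ?b t - t \<in> return_set \<Phi> e t"
    using boundary_return_in_return_set[OF slower] dir rotating by (auto simp: asymptotic_direction_def)
  then have return: "(?b ^^ n) t - t \<in> return_set \<Phi> e t"
    using funpow_boundary_return_in_return_set[OF flow] \<open>n \<ge> 1\<close> by blast
  have "\<Gamma> t = \<Gamma> ((?b ^^ n) t)"
    using periodic funpow_semiconj[of P \<Gamma> ?b n t] P_ext by simp
  then obtain k :: int where k: "(?b ^^ n) t - t = k * T"
    using orbit by fastforce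
  moreover have "(?b ^^ n) t - t > 0" "T > 0"
    using return flow by (auto simp: return_set_def linearized_flow_def)
  ultimately have "k > 0"
    by (simp add: zero_less_mult_iff)
  then have "real (nat k) * T \<in> return_set \<Phi> e t" "nat k \<ge> 1"
    using return k by auto
  then obtain u c where "u \<noteq> 0" "c > 0" "((*v) (\<Phi> 0 T) ^^ nat k) u = c *\<^sub>R u"
    using return_at_period_multiple_imp_monodromy_eigenvector[OF flow dir] by blast
  then show False
    using elliptic_power_positive_eigenvalue_imp_root_of_unity[OF elliptic] irrational
      \<open>nat k \<ge> 1\<close> by blast
qed

end
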